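(* Let $A\in\mathbb{R}^{m\times n}$ ($m,n\ge 1$) have no zero rows, let $r=\mathrm{rank}(A)$, and let $A=U\Sigma V^\top$ be a compact singular value decomposition. Let $\hat A$ and $L$ be as defined in the context, let $M=I_r-(\hat AV)^\top L^{-1}\hat AV$, and let $P_m:=I_n-\hat a_m\hat a_m^\top$. Then $$\|\Sigma M\|_{\mathrm{op}}^2\le\min\Big\{\|AP_m\|_{\mathrm{op}}^2\,\|M\|_{\mathrm{op}}^2,\ \frac{\max_{1\le i\le m}\|a_i\|^2\,\|L-I_m\|_{\mathrm{op}}^2\,\|AP_m\|_{\mathrm{op}}^2}{\|AP_m\|_{\mathrm{op}}^2+\max_{1\le i\le m}\|a_i\|^2\,\|L-I_m\|_{\mathrm{op}}^2}\Big\},$$ and additionally $$\|AP_m\|_{\mathrm{op}}^2\le\|AP_m\|_F^2=\sum_{i=1}^m\|a_i\|^2\big(1-\langle\hat a_i,\hat a_m\rangle^2\big)\quad\text{and}\quad\|AP_m\|_{\mathrm{op}}\le\sigma_1(A).$$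
   Context: $\|\cdot\|$ is the Euclidean norm on vectors, $\|\cdot\|_{\mathrm{op}}$ the induced operator (spectral) norm and $\|\cdot\|_F$ the Frobenius norm on matrices; $I_p$ is the $p\times p$ identity. The rows of $A$ are $a_1,\dots,a_m\in\mathbb{R}^n$ (viewed as column vectors), $\hat a_i=a_i/\|a_i\|$, and $\hat A\in\mathbb{R}^{m\times n}$ is the matrix with rows $\hat a_i$. $\sigma_1(A)$ is the largest singular value of $A$. Compact SVD: $A=U\Sigma V^\top$ with $U\in\mathbb{R}^{m\times r}$, $V\in\mathbb{R}^{n\times r}$, $U^\top U=V^\top V=I_r$, $\Sigma=\mathrm{diag}(\sigma_1,\dots,\sigma_r)$, $\sigma_1\ge\dots\ge\sigma_r>0$. $L\in\mathbb{R}^{m\times m}$ is the unit lower triangular matrix with $L_{ij}=\langle\hat a_i,\hat a_j\rangle$ for $j<i$, $L_{ii}=1$, $L_{ij}=0$ for $j>i$. Convention: an expression of the form $ab/(a+b)$ is taken to be $0$ when $a=b=0$. *)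

theory Defs
  imports "HOL-Analysis.Analysis"
begin

text \<open>
  Row and singular-value indices range over finite linearly ordered types, so that
  ``lower triangular'', ``the last row'' and ``in decreasing order'' make sense;
  the index \<open>m\<close> of the last row is \<open>Max UNIV\<close>.  The convention that
  \<open>a * b / (a + b)\<close> is \<open>0\<close> for \<open>a = b = 0\<close> is HOL's \<open>x / 0 = 0\<close>.
\<close>

definition op_norm :: "real^'n^'m \<Rightarrow> real" where
  "op_norm A = onorm ((*v) A)"

definition frob_norm :: "real^'n^'m \<Rightarrow> real" where
  "frob_norm A = sqrt (\<Sum>i\<in>UNIV. \<Sum>j\<in>UNIV. (A $ i $ j)\<^sup>2)"

definition singular_value :: "real^'n^'m \<Rightarrow> real \<Rightarrow> bool" where
  "singular_value A s \<longleftrightarrow>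
     0 \<le> s \<and> (\<exists>v. v \<noteq> 0 \<and> (transpose A ** A) *v v = s\<^sup>2 *\<^sub>R v)"

text \<open>
  If \<open>A\<close> has a nontrivial kernel, \<open>0\<close> also counts as a singular value; this does not
  affect the largest one.  The next lemma ensures that the maximum below is not vacuous
  because of an infinite set.
\<close>

lemma finite_singular_values:
  fixes A :: "real^'n^'m"
  shows "finite {s. singular_value A s}"
proof -
  let ?S = "{s. singular_value A s}"
  have "\<forall>s\<in>?S. \<exists>v. v \<noteq> 0 \<and> (transpose A ** A) *v v = s\<^sup>2 *\<^sub>R v"
    by (auto simp: singular_value_def)
  then obtain f where f: "\<And>s. s \<in> ?S \<Longrightarrow> f s \<noteq> 0"
      "\<And>s. s \<in> ?S \<Longrightarrow> (transpose A ** A) *v f s = s\<^sup>2 *\<^sub>R f s"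
    by metis
  have orth: "f s \<bullet> f t = 0" if "s \<in> ?S" "t \<in> ?S" "s \<noteq> t" for s t
  proof -
    have "s\<^sup>2 * (f s \<bullet> f t) = (transpose A ** A *v f s) \<bullet> f t"
      using f(2)[OF that(1)] by simp
    also have "\<dots> = f s \<bullet> (transpose A ** A *v f t)"
      by (metis dot_lmul_matrix inner_commute matrix_transpose_mul
          transpose_matrix_vector transpose_transpose)
    also have "\<dots> = t\<^sup>2 * (f s \<bullet> f t)"
      using f(2)[OF that(2)] by simp
    finally have "(s\<^sup>2 - t\<^sup>2) * (f s \<bullet> f t) = 0"
      by (simp add: algebra_simps)
    moreover have "s\<^sup>2 \<noteq> t\<^sup>2"
      using that by (auto simp: singular_value_def power2_eq_iff)
    ultimately show ?thesis by simp
  qed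
  have "inj_on f ?S"
    using orth f(1) by (metis inj_onI inner_eq_zero_iff)
  moreover have "finite (f ` ?S)"
  proof (rule pairwise_orthogonal_imp_finite)
    show "pairwise orthogonal (f ` ?S)"
      using orth by (auto simp: pairwise_def orthogonal_def)
  qed
  ultimately show ?thesis
    using finite_imageD by blast
qed

definition sigma1 :: "real^'n^'m \<Rightarrow> real" where
  "sigma1 A = Max {s. singular_value A s}"

definition compact_svd ::
  "real^'n^'m \<Rightarrow> real^'r::{finite,linorder}^'m \<Rightarrow> real^'r::{finite,linorder}^'r::{finite,linorder} \<Rightarrow> real^'r::{finite,linorder}^'n \<Rightarrow> bool" where
  "compact_svd A U \<Sigma> V \<longleftrightarrow>
     A = U ** \<Sigma> ** transpose V \<and>
     transpose U ** U = mat 1 \<and>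
     transpose V ** V = mat 1 \<and>
     (\<forall>i j. i \<noteq> j \<longrightarrow> \<Sigma> $ i $ j = 0) \<and>
     (\<forall>i. 0 < \<Sigma> $ i $ i) \<and>
     (\<forall>i j. i \<le> j \<longrightarrow> \<Sigma> $ j $ j \<le> \<Sigma> $ i $ i)"

definition unit_row :: "real^'n^'m \<Rightarrow> 'm \<Rightarrow> real^'n" where
  "unit_row A i = row i A /\<^sub>R norm (row i A)"

definition hat_mat :: "real^'n^'m \<Rightarrow> real^'n^'m" where
  "hat_mat A = (\<chi> i. unit_row A i)"

definition L_mat :: "real^'n^'m::{finite,linorder} \<Rightarrow> real^'m::{finite,linorder}^'m::{finite,linorder}" where
  "L_mat A = (\<chi> i j. if j < i then unit_row A i \<bullet> unit_row A j
                     else if j = i then 1 else 0)"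

definition M_mat :: "real^'n^'m::{finite,linorder} \<Rightarrow> real^'r^'n \<Rightarrow> real^'r^'r" where
  "M_mat A V = mat 1 - transpose (hat_mat A ** V) ** matrix_inv (L_mat A) ** (hat_mat A ** V)"

definition P_last :: "real^'n^'m::{finite,linorder} \<Rightarrow> real^'n^'n" where
  "P_last A = mat 1 - (\<chi> i j. unit_row A (Max UNIV) $ i * unit_row A (Max UNIV) $ j)"

definition max_row_norm_sq :: "real^'n^'m \<Rightarrow> real" where
  "max_row_norm_sq A = Max (range (\<lambda>i. (norm (row i A))\<^sup>2))"

end

theory Submission
  imports Defs
begin

text \<open>
  For \<open>y\<close> in the row space let \<open>c = L\<^sup>-\<^sup>1 \<hat>A y\<close> and \<open>z = y - \<hat>A\<^sup>T c\<close>, the result of one sweep of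
  Kaczmarz projections.  Everything follows from \<open>L + L\<^sup>T = \<hat>A \<hat>A\<^sup>T + I\<close>: it yields
  \<open>\<hat>A z = (I - L)\<^sup>T c\<close>, whose last entry vanishes (so \<open>P\<^sub>m z = z\<close>), and the Pythagorean
  identity \<open>\<parallel>y\<parallel>\<^sup>2 = \<parallel>z\<parallel>\<^sup>2 + \<parallel>c\<parallel>\<^sup>2\<close>.  Hence \<open>\<parallel>A z\<parallel>\<^sup>2\<close> is at most \<open>p \<parallel>z\<parallel>\<^sup>2\<close> and at most \<open>q \<parallel>c\<parallel>\<^sup>2\<close>,
  where \<open>p = \<parallel>A P\<^sub>m\<parallel>\<^sup>2\<close> and \<open>q = max \<parallel>a\<^sub>i\<parallel>\<^sup>2 \<parallel>L - I\<parallel>\<^sup>2\<close>, and a weighted sum of the two bounds gives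
  \<open>p q / (p + q)\<close>.
\<close>

text \<open>As a simp rule this turns \<open>transpose B *v x\<close> into \<open>x v* B\<close>;
  removing it keeps adjoints in the form used below.\<close>

declare transpose_matrix_vector [simp del]

section \<open>Operator and Frobenius norms\<close>

lemma norm_matrix_vector_le:
  fixes B :: "real^'n^'m"
  shows "norm (B *v x) \<le> op_norm B * norm x"
  unfolding op_norm_def by (rule onorm) simp

lemma op_norm_nonneg: "0 \<le> op_norm (B :: real^'n^'m)"
  unfolding op_norm_def by (rule onorm_pos_le) simp

lemma op_norm_le:
  fixes B :: "real^'n^'m"
  assumes "\<And>x. norm (B *v x) \<le> b * norm x"
  shows "op_norm B \<le> b"
  unfolding op_norm_def using assms by (rule onorm_le)

lemma op_norm_sq_le:
  fixes B :: "real^'n^'m"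
  assumes "0 \<le> b" "\<And>x. (norm (B *v x))\<^sup>2 \<le> b * (norm x)\<^sup>2"
  shows "(op_norm B)\<^sup>2 \<le> b"
proof -
  have "norm (B *v x) \<le> sqrt b * norm x" for x
    using real_sqrt_le_mono[OF assms(2)[of x]] by (simp add: real_sqrt_mult)
  then have "op_norm B \<le> sqrt b"
    by (rule op_norm_le)
  then show ?thesis
    using power_mono[OF _ op_norm_nonneg, of B "sqrt b" 2] assms(1) by simp
qed

lemma norm_sq_matrix_vector_le:
  fixes B :: "real^'n^'m"
  shows "(norm (B *v x))\<^sup>2 \<le> (op_norm B)\<^sup>2 * (norm x)\<^sup>2"
  using power_mono[OF norm_matrix_vector_le[of B x], of 2] by (simp add: power_mult_distrib)

lemma inner_matrix_vector:
  fixes B :: "real^'n^'m"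
  shows "x \<bullet> (B *v y) = (transpose B *v x) \<bullet> y"
  by (simp add: dot_lmul_matrix transpose_matrix_vector)

text \<open>Apply \<open>B\<close> to \<open>?w = transpose B *v x\<close> itself: the square of its
  norm is \<open>x \<bullet> (B *v ?w)\<close>, and one factor \<open>norm ?w\<close>
  cancels.\<close>

lemma norm_transpose_matrix_vector_le:
  fixes B :: "real^'n^'m"
  shows "norm (transpose B *v x) \<le> op_norm B * norm x"
proof -
  let ?w = "transpose B *v x"
  have "norm ?w * norm ?w = x \<bullet> (B *v ?w)"
    by (simp add: inner_matrix_vector dot_square_norm power2_eq_square)
  also have "\<dots> \<le> norm x * norm (B *v ?w)"
    by (rule norm_cauchy_schwarz)
  also have "\<dots> \<le> norm x * (op_norm B * norm ?w)"
    by (intro mult_left_mono norm_matrix_vector_le) simp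
  finally have *: "norm ?w * norm ?w \<le> (op_norm B * norm x) * norm ?w"
    by (simp add: mult_ac)
  show ?thesis
  proof (cases "norm ?w = 0")
    case True
    then show ?thesis by (simp add: op_norm_nonneg)
  next
    case False
    then show ?thesis using * by (simp add: mult_le_cancel_right)
  qed
qed

lemma norm_sq_vec: "(norm (x :: real^'n))\<^sup>2 = (\<Sum>i\<in>UNIV. (x $ i)\<^sup>2)"
  by (simp add: norm_vec_def L2_set_def sum_nonneg)

lemma frob_norm_sq:
  fixes B :: "real^'n^'m"
  shows "(frob_norm B)\<^sup>2 = (\<Sum>i\<in>UNIV. (norm (row i B))\<^sup>2)"
  by (simp add: frob_norm_def norm_sq_vec sum_nonneg row_def)

lemma matrix_vector_nth_row: "(B *v x) $ i = row i B \<bullet> (x :: real^'n)"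
  by (simp add: matrix_vector_mul_component row_def)

lemma op_norm_sq_le_frob_norm_sq:
  fixes B :: "real^'n^'m"
  shows "(op_norm B)\<^sup>2 \<le> (frob_norm B)\<^sup>2"
proof (rule op_norm_sq_le)
  fix x
  have "(norm (B *v x))\<^sup>2 = (\<Sum>i\<in>UNIV. (row i B \<bullet> x)\<^sup>2)"
    by (simp add: norm_sq_vec matrix_vector_nth_row)
  also have "\<dots> \<le> (\<Sum>i\<in>UNIV. (norm (row i B))\<^sup>2 * (norm x)\<^sup>2)"
  proof (rule sum_mono)
    fix i
    show "(row i B \<bullet> x)\<^sup>2 \<le> (norm (row i B))\<^sup>2 * (norm x)\<^sup>2"
      using Cauchy_Schwarz_ineq[of "row i B" x] by (simp add: dot_square_norm)
  qed
  finally show "(norm (B *v x))\<^sup>2 \<le> (frob_norm B)\<^sup>2 * (norm x)\<^sup>2"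
    by (simp add: frob_norm_sq sum_distrib_right)
qed simp

section \<open>Isometries and the largest singular value\<close>

lemma norm_isometry:
  fixes V :: "real^'r^'n"
  assumes "transpose V ** V = mat 1"
  shows "norm (V *v x) = norm x"
  using assms
  by (simp add: norm_eq_sqrt_inner inner_matrix_vector matrix_vector_mul_assoc)

lemma norm_transpose_isometry_le:
  fixes V :: "real^'r^'n"
  assumes "transpose V ** V = mat 1"
  shows "norm (transpose V *v x) \<le> norm x"
proof -
  have "op_norm V \<le> 1"
    by (rule op_norm_le) (simp add: norm_isometry[OF assms])
  then have "op_norm V * norm x \<le> 1 * norm x"
    by (intro mult_right_mono) auto
  then show ?thesis
    using norm_transpose_matrix_vector_le[of V x] by linarith
qed

lemma diagonal_matrix_vector_nth:
  fixes D :: "real^'r^'r"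
  assumes "\<And>i j. i \<noteq> j \<Longrightarrow> D $ i $ j = 0"
  shows "(D *v x) $ i = D $ i $ i * x $ i"
proof -
  have "(D *v x) $ i = (\<Sum>j\<in>UNIV. if j = i then D $ i $ i * x $ i else 0)"
    unfolding matrix_vector_mult_def vec_lambda_beta by (rule sum.cong) (use assms in auto)
  then show ?thesis by simp
qed

text \<open>The leading diagonal entry \<open>s\<close> of \<open>\<Sigma>\<close> links the two
  sides: it bounds \<open>op_norm A\<close>, as \<open>U\<close> is isometric and
  \<open>transpose V\<close> contracts, and it is a singular value, with the first column of
  \<open>V\<close> as eigenvector.\<close>

lemma op_norm_le_sigma1:
  assumes svd: "compact_svd A U \<Sigma> V"
  shows "op_norm A \<le> sigma1 A"
proof -
  define s where "s = \<Sigma> $ Min UNIV $ Min UNIV"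
  have A: "A = U ** \<Sigma> ** transpose V" and U: "transpose U ** U = mat 1"
    and V: "transpose V ** V = mat 1" and diag: "\<And>i j. i \<noteq> j \<Longrightarrow> \<Sigma> $ i $ j = 0"
    and pos: "\<And>i. 0 < \<Sigma> $ i $ i" and s_ge: "\<And>i. \<Sigma> $ i $ i \<le> s"
    using svd by (auto simp: compact_svd_def s_def)
  have Ax: "A *v x = U *v (\<Sigma> *v (transpose V *v x))" for x
    by (simp add: A matrix_vector_mul_assoc matrix_mul_assoc)
  have "norm (A *v x) \<le> s * norm x" for x
  proof -
    let ?y = "transpose V *v x"
    have "norm (A *v x) = norm (\<Sigma> *v ?y)"
      by (simp add: Ax norm_isometry[OF U])
    also have "\<dots> \<le> norm (s *\<^sub>R ?y)"
    proof (rule norm_le_componentwise_cart)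
      fix i
      show "norm ((\<Sigma> *v ?y) $ i) \<le> norm ((s *\<^sub>R ?y) $ i)"
        using pos[of i] s_ge[of i]
        by (auto simp: diagonal_matrix_vector_nth[OF diag] abs_mult intro!: mult_right_mono)
    qed
    also have "\<dots> \<le> s * norm x"
      using pos[of "Min UNIV"] norm_transpose_isometry_le[OF V, of x]
      by (simp add: s_def)
    finally show ?thesis .
  qed
  then have "op_norm A \<le> s"
    by (rule op_norm_le)
  also have "singular_value A s"
    unfolding singular_value_def
  proof (intro conjI exI)
    let ?e = "axis (Min UNIV) 1"
    show "0 \<le> s"
      using pos[of "Min UNIV"] by (simp add: s_def)
    show "V *v ?e \<noteq> 0"
      using norm_isometry[OF V, of ?e] by auto
    have \<Sigma>e: "\<Sigma> *v ?e = s *\<^sub>R ?e"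
      by (auto simp: vec_eq_iff diagonal_matrix_vector_nth[OF diag] s_def axis_def)
    have "transpose \<Sigma> = \<Sigma>"
      using diag by (auto simp: vec_eq_iff transpose_def) metis
    then have AT: "transpose A = V ** (\<Sigma> ** transpose U)"
      by (simp add: A matrix_transpose_mul)
    have "(transpose A ** A) *v (V *v ?e) =
        V *v (\<Sigma> *v ((transpose U ** U) *v (\<Sigma> *v ((transpose V ** V) *v ?e))))"
      \<comment> \<open>\<open>AT\<close> has to come first: unfolding \<open>A\<close> inside
        \<open>transpose A\<close> would destroy the pattern it matches.\<close>
      by (simp only: AT, simp only: A matrix_vector_mul_assoc matrix_mul_assoc)
    also have "\<dots> = s\<^sup>2 *\<^sub>R (V *v ?e)"
      by (simp add: U V \<Sigma>e matrix_vector_mult_scaleR power2_eq_square)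
    finally show "(transpose A ** A) *v (V *v ?e) = s\<^sup>2 *\<^sub>R (V *v ?e)" .
  qed
  then have "s \<le> sigma1 A"
    unfolding sigma1_def by (intro Max_ge finite_singular_values) simp
  finally show ?thesis .
qed

section \<open>Normalized rows and the projection \<open>P_last\<close>\<close>

lemma norm_unit_row: "row i A \<noteq> 0 \<Longrightarrow> norm (unit_row A i) = 1"
  by (simp add: unit_row_def)

lemma row_eq_scaleR_unit_row: "row i A = norm (row i A) *\<^sub>R unit_row A i"
  by (cases "row i A = 0") (auto simp: unit_row_def)

lemma P_last_vector:
  "P_last A *v x = x - (unit_row A (Max UNIV) \<bullet> x) *\<^sub>R unit_row A (Max UNIV)"
  by (simp add: P_last_def vec_eq_iff matrix_vector_mult_diff_rdistrib)
     (simp add: matrix_vector_mult_def inner_vec_def sum_distrib_left mult_ac)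

lemma transpose_P_last: "transpose (P_last A) = P_last A"
  by (auto simp: P_last_def transpose_def vec_eq_iff mat_def mult_ac)

lemma norm_sq_P_last:
  assumes "row (Max UNIV) A \<noteq> 0"
  shows "(norm (P_last A *v x))\<^sup>2 = (norm x)\<^sup>2 - (unit_row A (Max UNIV) \<bullet> x)\<^sup>2"
proof -
  have "unit_row A (Max UNIV) \<bullet> unit_row A (Max UNIV) = 1"
    using norm_unit_row[OF assms] by (simp add: dot_square_norm)
  then show ?thesis
    unfolding P_last_vector power2_norm_eq_inner
    by (simp add: inner_simps inner_commute power2_eq_square)
qed

lemma op_norm_P_last_le:
  assumes "row (Max UNIV) A \<noteq> 0"
  shows "op_norm (A ** P_last A) \<le> op_norm A"
proof (rule op_norm_le)
  fix x
  have "(norm (P_last A *v x))\<^sup>2 \<le> (norm x)\<^sup>2"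
    by (simp add: norm_sq_P_last[OF assms])
  then have "norm (P_last A *v x) \<le> norm x"
    by (rule power2_le_imp_le) simp
  then have "op_norm A * norm (P_last A *v x) \<le> op_norm A * norm x"
    by (rule mult_left_mono) (rule op_norm_nonneg)
  then show "norm ((A ** P_last A) *v x) \<le> op_norm A * norm x"
    using norm_matrix_vector_le[of A "P_last A *v x"]
    by (simp add: matrix_vector_mul_assoc)
qed

text \<open>As \<open>P_last A\<close> is symmetric, the rows of the product are the projected rows
  of \<open>A\<close>, and Pythagoras applies to each.\<close>

lemma frob_norm_P_last:
  assumes "row (Max UNIV) A \<noteq> 0"
  shows "(frob_norm (A ** P_last A))\<^sup>2 =
    (\<Sum>i\<in>UNIV. (norm (row i A))\<^sup>2 * (1 - (unit_row A i \<bullet> unit_row A (Max UNIV))\<^sup>2))"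
  unfolding frob_norm_sq
proof (rule sum.cong)
  fix i
  have "row i (A ** P_last A) = transpose (P_last A) *v row i A"
    by (simp add: vec_eq_iff row_def matrix_matrix_mult_def matrix_vector_mult_def
        transpose_def mult_ac)
  then have "(norm (row i (A ** P_last A)))\<^sup>2 =
      (norm (row i A))\<^sup>2 - (unit_row A (Max UNIV) \<bullet> row i A)\<^sup>2"
    by (simp add: transpose_P_last norm_sq_P_last[OF assms])
  also have "unit_row A (Max UNIV) \<bullet> row i A =
      norm (row i A) * (unit_row A i \<bullet> unit_row A (Max UNIV))"
    by (subst row_eq_scaleR_unit_row) (simp add: inner_commute)
  finally show "(norm (row i (A ** P_last A)))\<^sup>2 =
      (norm (row i A))\<^sup>2 * (1 - (unit_row A i \<bullet> unit_row A (Max UNIV))\<^sup>2)"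
    by (simp add: power_mult_distrib right_diff_distrib)
qed simp

section \<open>The matrices \<open>hat_mat\<close> and \<open>L_mat\<close>\<close>

lemma hat_mat_vector_nth: "(hat_mat A *v x) $ i = unit_row A i \<bullet> x"
  by (simp add: hat_mat_def matrix_vector_mul_component)

text \<open>Undoes the normalization; this is how the row norms enter the second bound. For a zero
  row both sides vanish.\<close>

lemma matrix_vector_nth_hat: "(A *v x) $ i = norm (row i A) * (hat_mat A *v x) $ i"
  unfolding hat_mat_vector_nth matrix_vector_nth_row[of A]
  by (subst row_eq_scaleR_unit_row) simp

text \<open>Off the diagonal, each Gram entry occurs in exactly one of the two triangles. On the
  diagonal, both sides are \<open>1 + 1\<close> because the rows are normalized.\<close>

lemma L_mat_plus_transpose:
  assumes "\<forall>i. row i A \<noteq> 0"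
  shows "L_mat A + transpose (L_mat A) = hat_mat A ** transpose (hat_mat A) + mat 1"
proof -
  have "unit_row A i \<bullet> unit_row A i = 1" for i
    using norm_unit_row[of i A] assms by (simp add: dot_square_norm)
  moreover have "(hat_mat A ** transpose (hat_mat A)) $ i $ j = unit_row A i \<bullet> unit_row A j" for i j
    by (simp add: hat_mat_def matrix_matrix_mult_def transpose_def inner_vec_def)
  ultimately show ?thesis
    by (auto simp: vec_eq_iff L_mat_def transpose_def mat_def inner_commute)
qed

lemma L_mat_vector_plus_transpose:
  assumes "\<forall>i. row i A \<noteq> 0"
  shows "L_mat A *v c + transpose (L_mat A) *v c =
    hat_mat A *v (transpose (hat_mat A) *v c) + c"
  using arg_cong[OF L_mat_plus_transpose[OF assms], of "\<lambda>B. B *v c"]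
  by (simp add: matrix_vector_mult_add_rdistrib matrix_vector_mul_assoc)

text \<open>A quadratic form sees only the symmetric part of its matrix.\<close>

lemma inner_L_mat:
  assumes "\<forall>i. row i A \<noteq> 0"
  shows "2 * (c \<bullet> (L_mat A *v c)) = (norm (transpose (hat_mat A) *v c))\<^sup>2 + (norm c)\<^sup>2"
proof -
  have "c \<bullet> (L_mat A *v c) = c \<bullet> (transpose (L_mat A) *v c)"
    by (simp add: inner_matrix_vector[of _ "L_mat A"] inner_commute)
  then have "2 * (c \<bullet> (L_mat A *v c)) = c \<bullet> (L_mat A *v c + transpose (L_mat A) *v c)"
    by (simp add: inner_add_right)
  then show ?thesis
    by (simp add: L_mat_vector_plus_transpose[OF assms] inner_add_right
        inner_matrix_vector[of _ "hat_mat A"] dot_square_norm)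
qed

text \<open>The symmetric part is positive definite by \<open>inner_L_mat\<close>, so the kernel is
  trivial; no determinant of a triangular matrix is computed.\<close>

lemma invertible_L_mat:
  assumes "\<forall>i. row i A \<noteq> 0"
  shows "invertible (L_mat A)"
proof -
  have "c = 0" if "L_mat A *v c = 0" for c
  proof -
    have "(norm (transpose (hat_mat A) *v c))\<^sup>2 + (norm c)\<^sup>2 = 0"
      using inner_L_mat[OF assms, of c] that by simp
    then show ?thesis
      by (simp add: add_nonneg_eq_0_iff)
  qed
  then show ?thesis
    by (simp add: invertible_left_inverse matrix_left_invertible_ker)
qed

lemma matrix_inv_right: "invertible B \<Longrightarrow> B ** matrix_inv B = mat 1"
  unfolding matrix_inv_def invertible_def by (rule someI2_ex) auto

section \<open>One sweep of projections, with \<open>c\<close> given by its linear system\<close>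

context
  fixes A :: "real^'n^'m::{finite,linorder}" and y z :: "real^'n" and c :: "real^'m::{finite,linorder}"
  assumes no_zero_rows: "\<forall>i. row i A \<noteq> 0"
    and Lc: "L_mat A *v c = hat_mat A *v y"
    and z: "z = y - transpose (hat_mat A) *v c"
begin

text \<open>With \<open>H = hat_mat A\<close> and \<open>L = L_mat A\<close>, the left side is
  \<open>L c - H H\<^sup>T c\<close>, and \<open>H H\<^sup>T = L + L\<^sup>T - I\<close>.\<close>

lemma sweep_residual: "hat_mat A *v z = - (transpose (L_mat A - mat 1) *v c)"
proof -
  have "transpose (L_mat A - mat 1) = transpose (L_mat A) - mat 1"
    by (auto simp: transpose_def vec_eq_iff mat_def)
  then have T: "transpose (L_mat A - mat 1) *v c = transpose (L_mat A) *v c - c"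
    by (simp add: matrix_vector_mult_diff_rdistrib)
  show ?thesis
    using L_mat_vector_plus_transpose[OF no_zero_rows, of c]
    by (simp add: T z matrix_vector_mult_diff_distrib Lc algebra_simps)
qed

text \<open>Expanding the square of \<open>z\<close>, the cross term is twice
  \<open>c \<bullet> (L_mat A *v c)\<close>, which \<open>inner_L_mat\<close> evaluates; the terms
  in \<open>transpose (hat_mat A) *v c\<close> cancel.\<close>

lemma sweep_pythagoras: "(norm y)\<^sup>2 = (norm z)\<^sup>2 + (norm c)\<^sup>2"
proof -
  have "y \<bullet> (transpose (hat_mat A) *v c) = c \<bullet> (L_mat A *v c)"
    by (metis Lc inner_matrix_vector inner_commute)
  then show ?thesis
    using inner_L_mat[OF no_zero_rows, of c]
    unfolding power2_norm_eq_inner by (simp add: z inner_simps inner_commute)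
qed

lemma P_last_sweep: "P_last A *v z = z"
proof -
  \<comment> \<open>\<open>L_mat A - mat 1\<close> is strictly lower triangular, so its last column
    is zero.\<close>
  have "(transpose (L_mat A - mat 1) *v c) $ Max UNIV = 0"
    by (auto simp: matrix_vector_mult_def transpose_def L_mat_def mat_def not_less
        intro!: sum.neutral)
  then have "unit_row A (Max UNIV) \<bullet> z = 0"
    by (simp add: sweep_residual flip: hat_mat_vector_nth)
  then show ?thesis
    by (simp add: P_last_vector)
qed

lemma norm_sq_sweep_le_last:
  "(norm (A *v z))\<^sup>2 \<le> (op_norm (A ** P_last A))\<^sup>2 * (norm z)\<^sup>2"
  using norm_sq_matrix_vector_le[of "A ** P_last A" z]
  by (simp add: P_last_sweep flip: matrix_vector_mul_assoc)

lemma norm_sq_sweep_le_L: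
  "(norm (A *v z))\<^sup>2 \<le> max_row_norm_sq A * (op_norm (L_mat A - mat 1))\<^sup>2 * (norm c)\<^sup>2"
proof -
  let ?w = "transpose (L_mat A - mat 1) *v c"
  have row_le: "(norm (row i A))\<^sup>2 \<le> max_row_norm_sq A" for i
    by (simp add: max_row_norm_sq_def)
  then have "0 \<le> max_row_norm_sq A"
    using order_trans zero_le_power2 by blast
  have "(norm (A *v z))\<^sup>2 = (\<Sum>i\<in>UNIV. (norm (row i A))\<^sup>2 * (?w $ i)\<^sup>2)"
    by (simp add: norm_sq_vec[of "A *v z"] matrix_vector_nth_hat[of A] sweep_residual power_mult_distrib)
  also have "\<dots> \<le> (\<Sum>i\<in>UNIV. max_row_norm_sq A * (?w $ i)\<^sup>2)"
    by (intro sum_mono mult_right_mono row_le) simp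
  also have "\<dots> = max_row_norm_sq A * (norm ?w)\<^sup>2"
    by (simp add: norm_sq_vec[of ?w] sum_distrib_left)
  also have "\<dots> \<le> max_row_norm_sq A * (op_norm (L_mat A - mat 1) * norm c)\<^sup>2"
    by (intro mult_left_mono power_mono norm_transpose_matrix_vector_le) (use \<open>0 \<le> _\<close> in auto)
  finally show ?thesis
    by (simp add: power_mult_distrib mult_ac)
qed

end

section \<open>Combining the two bounds and returning to \<open>M_mat\<close>\<close>

lemma le_harmonic_combination:
  fixes p q :: real
  assumes "0 \<le> p" "0 \<le> q" "t \<le> p * a" "t \<le> q * b"
  shows "t \<le> q * p / (p + q) * (a + b)"
proof (cases "p + q = 0")
  case True
  \<comment> \<open>Here the quotient is \<open>0\<close> by convention, and the hypotheses already
    give \<open>t \<le> 0\<close>.\<close>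
  then have "p = 0" "q = 0" using assms by linarith+
  then show ?thesis using assms by simp
next
  case False
  then have pq: "0 < p + q" using assms by linarith
  \<comment> \<open>Cross weights \<open>q\<close> and \<open>p\<close> give both bounds the same
    coefficient \<open>q * p\<close>.\<close>
  have "q * t \<le> q * (p * a)" "p * t \<le> p * (q * b)"
    using assms by (auto intro: mult_left_mono)
  then have "t * (p + q) \<le> q * p * (a + b)"
    by (simp add: algebra_simps)
  then have "t \<le> q * p * (a + b) / (p + q)"
    by (simp only: pos_le_divide_eq[OF pq])
  then show ?thesis
    by (simp only: times_divide_eq_left)
qed

text \<open>The hypothesis passes from the rows of \<open>A\<close> to their multiples, the rows of
  \<open>hat_mat A\<close>; transposing gives the claim, since \<open>V ** transpose V\<close> is
  symmetric.\<close>

lemma hat_mat_projection: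
  assumes "A ** V ** transpose V = A"
  shows "V *v (transpose V *v (transpose (hat_mat A) *v c)) = transpose (hat_mat A) *v c"
proof -
  have "hat_mat A *v ((V ** transpose V) *v x) = hat_mat A *v x" for x
  proof -
    have "A *v ((V ** transpose V) *v x) = A *v x"
      using assms by (simp add: matrix_vector_mul_assoc matrix_mul_assoc)
    then have "row i A \<bullet> ((V ** transpose V) *v x) = row i A \<bullet> x" for i
      by (simp flip: matrix_vector_nth_row)
    then show ?thesis
      by (simp add: vec_eq_iff hat_mat_vector_nth unit_row_def)
  qed
  then have "hat_mat A ** (V ** transpose V) = hat_mat A"
    by (simp add: matrix_eq flip: matrix_vector_mul_assoc)
  then have "transpose (hat_mat A ** (V ** transpose V)) *v c = transpose (hat_mat A) *v c"
    by simp
  then show ?thesis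
    by (simp add: matrix_transpose_mul matrix_vector_mul_assoc matrix_mul_assoc)
qed

theorem lemma2:
  fixes A :: "real^'n^'m::{finite,linorder}"
    and U :: "real^'r::{finite,linorder}^'m::{finite,linorder}"
    and \<Sigma> :: "real^'r::{finite,linorder}^'r::{finite,linorder}"
    and V :: "real^'r::{finite,linorder}^'n"
  assumes no_zero_rows: "\<forall>i. row i A \<noteq> 0"
    and rank: "CARD('r) = rank A"
    and svd: "compact_svd A U \<Sigma> V"
  shows "((op_norm (\<Sigma> ** M_mat A V))\<^sup>2 \<le>
           min ((op_norm (A ** P_last A))\<^sup>2 * (op_norm (M_mat A V))\<^sup>2)
               ((max_row_norm_sq A * (op_norm (L_mat A - mat 1))\<^sup>2 * (op_norm (A ** P_last A))\<^sup>2)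
                / ((op_norm (A ** P_last A))\<^sup>2
                   + max_row_norm_sq A * (op_norm (L_mat A - mat 1))\<^sup>2))) \<and>
         ((op_norm (A ** P_last A))\<^sup>2 \<le> (frob_norm (A ** P_last A))\<^sup>2) \<and>
         ((frob_norm (A ** P_last A))\<^sup>2 =
           (\<Sum>i\<in>UNIV. (norm (row i A))\<^sup>2 * (1 - (unit_row A i \<bullet> unit_row A (Max UNIV))\<^sup>2))) \<and>
         (op_norm (A ** P_last A) \<le> sigma1 A)"
proof -
  let ?p = "(op_norm (A ** P_last A))\<^sup>2"
  let ?q = "max_row_norm_sq A * (op_norm (L_mat A - mat 1))\<^sup>2"
  let ?M = "M_mat A V"
  have A: "A = U ** \<Sigma> ** transpose V" and U: "transpose U ** U = mat 1"
    and V: "transpose V ** V = mat 1"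
    using svd by (auto simp: compact_svd_def)
  have AV: "A ** V = U ** \<Sigma>"
    by (simp add: A V flip: matrix_mul_assoc)
  have AVV: "A ** V ** transpose V = A"
    by (simp add: AV flip: A)
  have "0 \<le> max_row_norm_sq A"
    unfolding max_row_norm_sq_def by (rule order_trans[OF zero_le_power2 Max_ge]) auto
  then have q0: "0 \<le> ?q" by simp
  define c where "c x = matrix_inv (L_mat A) *v (hat_mat A *v (V *v x))" for x
  define z where "z x = V *v x - transpose (hat_mat A) *v c x" for x
  have Lc: "L_mat A *v c x = hat_mat A *v (V *v x)" for x
    by (simp add: c_def matrix_vector_mul_assoc matrix_mul_assoc matrix_inv_right invertible_L_mat no_zero_rows)
  \<comment> \<open>\<open>?M\<close> is the sweep expressed in the coordinates of \<open>V\<close>: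
    the start is \<open>V *v x\<close>, and the subtracted vector is fixed by
    \<open>V ** transpose V\<close>.\<close>
  have VM: "V *v (?M *v x) = z x" for x
  proof -
    have "?M *v x = x - transpose V *v (transpose (hat_mat A) *v c x)"
      by (simp add: M_mat_def c_def matrix_vector_mult_diff_rdistrib matrix_transpose_mul
          matrix_vector_mul_assoc matrix_mul_assoc)
    then show ?thesis
      by (simp add: z_def matrix_vector_mult_diff_distrib hat_mat_projection[OF AVV])
  qed
  have norm_z: "norm (z x) = norm (?M *v x)" for x
    by (simp add: norm_isometry[OF V] flip: VM)
  have norm_\<Sigma>M: "norm ((\<Sigma> ** ?M) *v x) = norm (A *v z x)" for x
  proof -
    \<comment> \<open>Since \<open>A ** V = U ** \<Sigma>\<close>, applying \<open>A\<close> to the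
      residual gives \<open>\<Sigma> ** ?M\<close> up to the isometry \<open>U\<close>.\<close>
    have "A *v z x = U *v ((\<Sigma> ** ?M) *v x)"
      by (simp add: AV matrix_vector_mul_assoc matrix_mul_assoc flip: VM)
    then show ?thesis
      by (simp add: norm_isometry[OF U])
  qed
  have le_p: "(norm (A *v z x))\<^sup>2 \<le> ?p * (norm (z x))\<^sup>2" for x
    by (rule norm_sq_sweep_le_last[OF no_zero_rows Lc z_def])
  have le_q: "(norm (A *v z x))\<^sup>2 \<le> ?q * (norm (c x))\<^sup>2" for x
    by (rule norm_sq_sweep_le_L[OF no_zero_rows Lc z_def])
  have "(op_norm (\<Sigma> ** ?M))\<^sup>2 \<le> ?p * (op_norm ?M)\<^sup>2"
  proof (rule op_norm_sq_le)
    fix x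
    have "?p * (norm (z x))\<^sup>2 \<le> ?p * ((op_norm ?M)\<^sup>2 * (norm x)\<^sup>2)"
      by (intro mult_left_mono) (simp_all add: norm_z norm_sq_matrix_vector_le)
    with le_p[of x] show "(norm ((\<Sigma> ** ?M) *v x))\<^sup>2 \<le> ?p * (op_norm ?M)\<^sup>2 * (norm x)\<^sup>2"
      by (simp add: norm_\<Sigma>M mult.assoc)
  qed simp
  moreover have "(op_norm (\<Sigma> ** ?M))\<^sup>2 \<le> ?q * ?p / (?p + ?q)"
  proof (rule op_norm_sq_le)
    fix x
    \<comment> \<open>This turns the factor \<open>a + b\<close> of the combined bound into the
      squared norm of \<open>x\<close>.\<close>
    have "(norm x)\<^sup>2 = (norm (z x))\<^sup>2 + (norm (c x))\<^sup>2"
      using sweep_pythagoras[OF no_zero_rows Lc z_def, of x] by (simp add: norm_isometry[OF V])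
    with le_harmonic_combination[OF _ q0 le_p le_q, of x]
    show "(norm ((\<Sigma> ** ?M) *v x))\<^sup>2 \<le> ?q * ?p / (?p + ?q) * (norm x)\<^sup>2"
      by (simp add: norm_\<Sigma>M)
  qed (use q0 in simp)
  moreover have "op_norm (A ** P_last A) \<le> sigma1 A"
    using op_norm_P_last_le op_norm_le_sigma1[OF svd] no_zero_rows order_trans by blast
  ultimately show ?thesis
    using no_zero_rows op_norm_sq_le_frob_norm_sq[of "A ** P_last A"]
    by (simp add: frob_norm_P_last)
qed

end
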